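(* For each odd $n\in\mathbb{N}$, the equation $z^{n+1}=(1+z)^n$ has exactly one negative real root in the interval $(-1,0)$.
   Context: $\mathbb{N}=\{1,2,3,\dots\}$. *)

theory Defs
  imports Complex_Main
begin

end

theory Submission
  imports Defs
begin

text \<open>For odd \<open>n\<close> the exponent \<open>n + 1\<close> is even, so on \<open>[-1, 0]\<close> the left-hand side falls strictly
  from 1 to 0 while the right-hand side rises strictly from 0 to 1.\<close>

theorem theorem2p8:
  fixes n :: nat
  assumes "odd n"
  shows "\<exists>!z::real. z \<in> {-1<..<0} \<and> z ^ (n + 1) = (1 + z) ^ n"
proof -
  define f where "f = (\<lambda>z::real. (1 + z) ^ n - z ^ (n + 1))"
  have n: "0 < n" "even (n + 1)"
    using assms by (auto simp: odd_pos)
  have f_mono: "f x < f y" if "-1 \<le> x" "x < y" "y \<le> 0" for x y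
  proof -
    have "(1 + x) ^ n < (1 + y) ^ n"
      using that n by (intro power_strict_mono) auto
    \<comment> \<open>Negating gives the nonnegative bases that \<open>power_strict_mono\<close>
      needs; evenness of \<open>n + 1\<close> then removes the signs.\<close>
    moreover have "(- y) ^ (n + 1) < (- x) ^ (n + 1)"
      using that by (intro power_strict_mono) auto
    ultimately show ?thesis
      using n(2) by (simp only: f_def power_minus_even)
  qed
  \<comment> \<open>At \<open>-1\<close>, \<open>0 < n\<close> makes \<open>0 ^ n\<close> vanish,
    and evenness of \<open>n + 1\<close> gives \<open>(-1) ^ (n + 1) = 1\<close>.\<close>
  have ends: "f (-1) = -1" "f 0 = 1"
    using n by (simp_all add: f_def)
  have "\<exists>z\<ge>-1. z \<le> 0 \<and> f z = 0"
  proof (rule IVT')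
    show "continuous_on {-1..0} f"
      unfolding f_def by (intro continuous_intros)
  qed (simp_all add: ends)
  then obtain z where z: "-1 \<le> z" "z \<le> 0" "f z = 0"
    by blast
  \<comment> \<open>The intermediate value theorem only places the root in the closed interval; the
    nonzero end values exclude the endpoints.\<close>
  moreover have "z \<noteq> -1" "z \<noteq> 0"
    using z(3) ends by auto
  ultimately have "z \<in> {-1<..<0}"
    by simp
  moreover have "y = z" if "y \<in> {-1<..<0}" "f y = 0" for y
  proof (cases y z rule: linorder_cases)
    case less
    with f_mono[of y z] that z show ?thesis by simp
  next
    case greater
    with f_mono[of z y] that z show ?thesis by simp
  qed
  ultimately have "\<exists>!z. z \<in> {-1<..<0} \<and> f z = 0"
    using z(3) by blast
  moreover have "f z = 0 \<longleftrightarrow> z ^ (n + 1) = (1 + z) ^ n" for z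
    unfolding f_def by linarith
  ultimately show ?thesis
    by (simp only:)
qed

end
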